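(* Let $S$ be a finite semigroup. The enhanced power graph $P_e(S)$ is equal to the cyclic graph $\Gamma(S)$ if and only if for each $a\in S$, one of the following holds for some $r\in\mathbb{N}$: (i) $\langle a\rangle=\langle a : a^{1+r}=a\rangle$; (ii) $\langle a\rangle=\langle a : a^{2+r}=a^2\rangle$; (iii) $\langle a\rangle=\langle a : a^{3+r}=a^3\rangle$ where $r$ is odd.
   Context: $\mathbb{N}$ is the set of positive integers. For $X\subseteq S$, $\langle X\rangle$ is the subsemigroup generated by $X$; $\langle a\rangle=\{a^k:k\in\mathbb{N}\}$. For an element $a$ of a finite semigroup, the index $m$ of $a$ is the least $x\in\mathbb{N}$ such that $a^x=a^y$ for some $y\in\mathbb{N}$, $y\neq x$, and the period $r$ of $a$ is the least $x\in\mathbb{N}$ with $a^{m+x}=a^m$. Writing $\langle a\rangle=\langle a : a^{m+r}=a^m\rangle$ (also denoted $M(m,r)$) means that $a$ has index exactly $m$ and period exactly $r$. Both graphs below are simple graphs with vertex set $S$. In the enhanced power graph $P_e(S)$, two distinct vertices $x,y$ are adjacent if and only if there is $z\in S$ with $x,y\in\langle z\rangle$. In the cyclic graph $\Gamma(S)$, two distinct vertices $x,y$ are adjacent if and only if $\langle x,y\rangle=\langle z\rangle$ for some $z\in S$. Two graphs on $S$ are equal if they have the same edges. *)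

theory Defs
  imports Main
begin

inductive_set gen :: "'a::semigroup_mult set \<Rightarrow> 'a set" ("\<langle>_\<rangle>") for X where
  base: "x \<in> X \<Longrightarrow> x \<in> \<langle>X\<rangle>"
| mult: "x \<in> \<langle>X\<rangle> \<Longrightarrow> y \<in> \<langle>X\<rangle> \<Longrightarrow> x * y \<in> \<langle>X\<rangle>"

text \<open>A semigroup need not have an identity, so \<open>spow a k\<close> is the power \<open>a\<^sup>k\<close> only for
  \<open>k > 0\<close>; the value at \<open>0\<close> is a dummy, and every use below has a positive exponent.\<close>

fun spow :: "'a::semigroup_mult \<Rightarrow> nat \<Rightarrow> 'a" where
  "spow a 0 = a"
| "spow a (Suc 0) = a"
| "spow a (Suc (Suc n)) = spow a (Suc n) * a"

lemma spow_Suc: "k > 0 \<Longrightarrow> spow a (Suc k) = spow a k * a"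
  by (cases k) auto

lemma spow_add: "i > 0 \<Longrightarrow> j > 0 \<Longrightarrow> spow a (i + j) = spow a i * spow a j"
proof (induction j)
  case (Suc j)
  then show ?case
    by (cases "j = 0") (auto simp: spow_Suc mult.assoc)
qed simp

lemma gen_singleton: "\<langle>{a}\<rangle> = {spow a k | k. k > 0}"
proof
  show "\<langle>{a}\<rangle> \<subseteq> {spow a k | k. k > 0}"
  proof
    fix x assume "x \<in> \<langle>{a}\<rangle>"
    then show "x \<in> {spow a k | k. k > 0}"
    proof induction
      case (base x)
      then show ?case by (auto intro!: exI[of _ "Suc 0"])
    next
      case (mult x y)
      then obtain i j where "x = spow a i" "i > 0" "y = spow a j" "j > 0"
        by auto
      then show ?case
        by (auto intro!: exI[of _ "i + j"] simp: spow_add)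
    qed
  qed
  have "spow a k \<in> \<langle>{a}\<rangle>" if "k > 0" for k
    using that
  proof (induction k)
    case (Suc k)
    then show ?case
      by (cases "k = 0") (auto simp: spow_Suc intro: gen.intros)
  qed simp
  then show "{spow a k | k. k > 0} \<subseteq> \<langle>{a}\<rangle>" by auto
qed

definition index :: "'a::semigroup_mult \<Rightarrow> nat" where
  "index a = (LEAST x. x > 0 \<and> (\<exists>y>0. y \<noteq> x \<and> spow a x = spow a y))"

definition period :: "'a::semigroup_mult \<Rightarrow> nat" where
  "period a = (LEAST x. x > 0 \<and> spow a (index a + x) = spow a (index a))"

text \<open>\<open>monogenic a m r\<close> is \<open>\<langle>a\<rangle> = \<langle>a : a\<^sup>m\<^sup>+\<^sup>r = a\<^sup>m\<rangle>\<close>, with \<open>m\<close> and \<open>r\<close> the exact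
  index and period of \<open>a\<close>.\<close>

definition monogenic :: "'a::semigroup_mult \<Rightarrow> nat \<Rightarrow> nat \<Rightarrow> bool" where
  "monogenic a m r \<longleftrightarrow> index a = m \<and> period a = r"

text \<open>The \<open>LEAST\<close> in \<open>index\<close> and \<open>period\<close> is over a nonempty set in the finite case.\<close>

lemma index_period_exist:
  fixes a :: "'a::{semigroup_mult, finite}"
  shows "index a > 0" "\<exists>y>0. y \<noteq> index a \<and> spow a (index a) = spow a y"
    "period a > 0" "spow a (index a + period a) = spow a (index a)"
proof -
  have "\<not> inj_on (spow a) {0<..}"
    using finite_imageD[of "spow a" "{0<..}"] infinite_Ioi by auto
  then have "\<exists>x. x > 0 \<and> (\<exists>y>0. y \<noteq> x \<and> spow a x = spow a y)"
    by (auto simp: inj_on_def)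
  from LeastI_ex[OF this]
  have *: "index a > 0 \<and> (\<exists>y>0. y \<noteq> index a \<and> spow a (index a) = spow a y)"
    unfolding index_def .
  then show "index a > 0" "\<exists>y>0. y \<noteq> index a \<and> spow a (index a) = spow a y"
    by auto
  from * obtain y where y: "y > 0" "y \<noteq> index a" "spow a (index a) = spow a y"
    by auto
  have "\<not> y < index a"
  proof
    assume "y < index a"
    then have "\<not> (y > 0 \<and> (\<exists>z>0. z \<noteq> y \<and> spow a y = spow a z))"
      unfolding index_def by (rule not_less_Least)
    with y * show False by metis
  qed
  with y have "y - index a > 0 \<and> spow a (index a + (y - index a)) = spow a (index a)"
    by auto
  then have "\<exists>x. x > 0 \<and> spow a (index a + x) = spow a (index a)" ..
  from LeastI_ex[OF this] show "period a > 0" "spow a (index a + period a) = spow a (index a)"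
    unfolding period_def by auto
qed

text \<open>A simple graph is a pair of a vertex set and a set of edges, each edge being an unordered
  pair \<open>{x, y}\<close> of distinct vertices.\<close>

type_synonym 'a graph = "'a set \<times> 'a set set"

definition enhanced_power_graph :: "'a::semigroup_mult graph" ("P\<^sub>e") where
  "P\<^sub>e = (UNIV, {{x, y} | x y. x \<noteq> y \<and> (\<exists>z. x \<in> \<langle>{z}\<rangle> \<and> y \<in> \<langle>{z}\<rangle>)})"

definition cyclic_graph :: "'a::semigroup_mult graph" ("\<Gamma>") where
  "\<Gamma> = (UNIV, {{x, y} | x y. x \<noteq> y \<and> (\<exists>z. \<langle>{x, y}\<rangle> = \<langle>{z}\<rangle>)})"

end

theory Submission
  imports Defs
begin

text \<open>
  Two elements that generate a monogenic subsemigroup lie in that subsemigroup, so every edge of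
  \<open>\<Gamma>\<close> is an edge of \<open>P\<^sub>e\<close>. The two graphs are therefore equal iff any two powers
  \<open>a\<^sup>i, a\<^sup>j\<close> of any element \<open>a\<close> together generate a monogenic subsemigroup
  (\<open>graphs_eq_iff\<close>). Whether they do depends only on the index \<open>m\<close> and the period
  \<open>r\<close> of \<open>a\<close>.

  The powers \<open>a\<^sup>k\<close> with \<open>k \<ge> m\<close> form a cyclic group, in which a pair of
  elements never causes trouble, by Bezout's identity (\<open>monogenic_pair_in_kernel\<close>). A pair
  containing \<open>a\<close> generates \<open>\<langle>a\<rangle>\<close>. This settles \<open>m \<le> 2\<close>. For
  \<open>m = 3\<close> the remaining pairs are \<open>a\<^sup>2, a\<^sup>j\<close> with \<open>j \<ge> 3\<close>; if \<open>r\<close> is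
  odd, one of \<open>j\<close>, \<open>j + r\<close> is even, so \<open>a\<^sup>j\<close> is a power of \<open>a\<^sup>2\<close>.

  In all other cases the pair \<open>a\<^sup>2, a\<^sup>3\<close> is an obstruction
  (\<open>square_cube_not_monogenic\<close>). As \<open>m \<ge> 3\<close>, the exponent of \<open>a\<^sup>2\<close> is
  unambiguous, which forces a single generator of \<open>\<langle>a\<^sup>2, a\<^sup>3\<rangle>\<close> to be \<open>a\<^sup>2\<close>
  itself; but \<open>a\<^sup>3\<close> is a power of \<open>a\<^sup>2\<close> only if \<open>m = 3\<close> and an even exponent
  is congruent to \<open>3\<close> modulo \<open>r\<close>, that is, \<open>r\<close> is odd.
\<close>

section \<open>Generated subsemigroups and powers\<close>

lemma gen_least: "X \<subseteq> \<langle>Y\<rangle> \<Longrightarrow> \<langle>X\<rangle> \<subseteq> \<langle>Y\<rangle>"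
proof
  fix x assume "X \<subseteq> \<langle>Y\<rangle>" "x \<in> \<langle>X\<rangle>"
  from this(2,1) show "x \<in> \<langle>Y\<rangle>"
    by induction (auto intro: gen.mult)
qed

lemma gen_pair_eq_singletonI:
  assumes "x \<in> \<langle>{z}\<rangle>" "y \<in> \<langle>{z}\<rangle>" "z \<in> \<langle>{x, y}\<rangle>"
  shows "\<langle>{x, y}\<rangle> = \<langle>{z}\<rangle>"
  using assms by (intro equalityI gen_least) auto

lemma spow_in_gen: "x \<in> \<langle>X\<rangle> \<Longrightarrow> k > 0 \<Longrightarrow> spow x k \<in> \<langle>X\<rangle>"
  using gen_least[of "{x}" X] by (auto simp: gen_singleton)

lemma spow_mult: "i > 0 \<Longrightarrow> j > 0 \<Longrightarrow> spow (spow a i) j = spow a (i * j)"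
proof (induction j)
  case (Suc j)
  then show ?case
    by (cases "j = 0") (auto simp: spow_Suc spow_add[symmetric] add.commute)
qed simp

lemma spow_mult_in_gen: "i > 0 \<Longrightarrow> t > 0 \<Longrightarrow> spow a (i * t) \<in> \<langle>{spow a i}\<rangle>"
  by (auto simp: gen_singleton spow_mult[symmetric])

section \<open>Index and period\<close>

lemma spow_eq_below_index:
  assumes "spow a i = spow a j" "0 < i" "i < index a" "0 < j"
  shows "j = i"
  using not_less_Least[OF assms(3)[unfolded index_def]] assms(1,2,4) by blast

lemma spow_add_period_mult:
  fixes a :: "'a::{semigroup_mult, finite}"
  assumes "index a \<le> k"
  shows "spow a (k + period a * t) = spow a k"
proof (induction t)
  case (Suc t)
  let ?m = "index a" and ?r = "period a"
  \<comment> \<open>A dummy exponent \<open>0\<close> must be avoided when splitting off \<open>a\<^sup>m\<close>, so the case of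
    a vanishing remainder is separate.\<close>
  have step: "spow a (l + ?r) = spow a l" if l: "?m \<le> l" for l
  proof (cases "l = ?m")
    case True
    then show ?thesis by (simp add: index_period_exist(4))
  next
    case False
    then obtain d where d: "l = ?m + d" "d > 0"
      using l less_imp_add_positive[of ?m l] by auto
    have "spow a (l + ?r) = spow a (?m + ?r) * spow a d"
      using d index_period_exist(1)[of a] spow_add[of "?m + ?r" d a] by (simp add: ac_simps)
    also have "\<dots> = spow a l"
      using d index_period_exist(1)[of a] by (simp add: index_period_exist(4) spow_add)
    finally show ?thesis .
  qed
  then show ?case
    using step[of "k + ?r * t"] Suc assms by (simp add: ac_simps)
qed simp

lemma period_dvd:
  fixes a :: "'a::{semigroup_mult, finite}"
  assumes "spow a (index a + x) = spow a (index a)"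
  shows "period a dvd x"
proof (rule ccontr)
  let ?m = "index a" and ?r = "period a"
  let ?x' = "x mod ?r"
  assume "\<not> ?r dvd x"
  then have "?x' > 0"
    by (auto simp: dvd_eq_mod_eq_0)
  have "?m + x = (?m + ?x') + ?r * (x div ?r)"
    by simp
  then have "spow a (?m + ?x') = spow a ?m"
    using spow_add_period_mult[of a "?m + ?x'" "x div ?r"] assms by (metis le_add1)
  with \<open>?x' > 0\<close> have "?r \<le> ?x'"
    unfolding period_def by (intro Least_le) auto
  then show False
    using mod_less_divisor[OF index_period_exist(3), of x a] by simp
qed

section \<open>When two powers generate a monogenic subsemigroup\<close>

text \<open>Beyond the index, exponents matter only modulo the period \<open>r\<close>. Bezout's identity
  \<open>i x = j y + d\<close>, with \<open>d\<close> a common divisor of \<open>i\<close> and \<open>j\<close>, gives after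
  replacing \<open>- y\<close> by \<open>(r - 1) y\<close> a positive exponent
  \<open>n = i x + j y (r - 1) = d + r j y\<close> that is at least \<open>i\<close> and congruent to \<open>d\<close>
  modulo \<open>r\<close>. The first form puts \<open>a\<^sup>n\<close> into \<open>\<langle>a\<^sup>i, a\<^sup>j\<rangle>\<close>, and the second
  makes \<open>a\<^sup>i\<close> and \<open>a\<^sup>j\<close> powers of \<open>a\<^sup>n\<close>.\<close>

lemma monogenic_pair_in_kernel:
  fixes a :: "'a::{semigroup_mult, finite}"
  assumes "index a \<le> i" "index a \<le> j"
  shows "\<exists>w. \<langle>{spow a i, spow a j}\<rangle> = \<langle>{w}\<rangle>"
proof -
  let ?r = "period a"
  have pos: "i > 0" "j > 0" "?r > 0"
    using assms index_period_exist(1)[of a] index_period_exist(3)[of a] by auto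
  obtain d x y where d: "d dvd i" "d dvd j" and bezout: "i * x = j * y + d"
    using bezout_add_strong_nat[of i j] pos by auto
  have "d > 0"
    using d pos by (auto intro: Nat.gr0I)
  then have "x > 0"
    using bezout by (auto intro: Nat.gr0I)
  define n where "n = d + ?r * (j * y)"
  have n_comb: "n = i * x + j * (y * (?r - 1))"
    using bezout pos by (cases ?r) (auto simp: n_def algebra_simps)
  have "n > 0"
    using \<open>d > 0\<close> by (simp add: n_def)
  have power_of_n: "spow a k \<in> \<langle>{spow a n}\<rangle>" if k: "d dvd k" "index a \<le> k" "k > 0" for k
  proof -
    obtain p where p: "k = d * p" "p > 0"
      using k by (auto elim!: dvdE)
    have "n * p = k + ?r * (j * y * p)"
      by (simp add: n_def p algebra_simps)
    then have "spow a k = spow a (n * p)"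
      using spow_add_period_mult[OF k(2)] by simp
    then show ?thesis
      using spow_mult_in_gen[OF \<open>n > 0\<close> p(2)] by simp
  qed
  have "spow a n \<in> \<langle>{spow a i, spow a j}\<rangle>"
  proof -
    have i_part: "spow a (i * x) \<in> \<langle>{spow a i, spow a j}\<rangle>"
      using pos \<open>x > 0\<close> by (simp add: spow_in_gen gen.base flip: spow_mult)
    show ?thesis
    proof (cases "y * (?r - 1) = 0")
      case True
      then have "n = i * x" using n_comb by (simp only: mult_0_right add_0_right)
      then show ?thesis using i_part by simp
    next
      case False
      then have "spow a n = spow a (i * x) * spow (spow a j) (y * (?r - 1))"
        using pos \<open>x > 0\<close> by (simp add: n_comb spow_add spow_mult)
      then show ?thesis
        using False i_part by (simp add: gen.mult spow_in_gen gen.base)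
    qed
  qed
  then have "\<langle>{spow a i, spow a j}\<rangle> = \<langle>{spow a n}\<rangle>"
    using power_of_n d assms pos by (intro gen_pair_eq_singletonI) auto
  then show ?thesis ..
qed

text \<open>By symmetry the smaller exponent comes first. Only the exponents \<open>1\<close> and \<open>2\<close>
  can lie below the index; an element with exponent \<open>1\<close> generates everything, and for
  exponent \<open>2\<close> the odd period allows the parity of the other exponent to be corrected.\<close>

lemma monogenic_pair_of_small_index:
  fixes a :: "'a::{semigroup_mult, finite}"
  assumes small: "index a \<le> 2 \<or> (index a = 3 \<and> odd (period a))"
    and "0 < i" "i \<le> j"
  shows "\<exists>w. \<langle>{spow a i, spow a j}\<rangle> = \<langle>{w}\<rangle>"
proof -
  consider "index a \<le> i" | "i = 1" | "i = 2" "j = 2" | "i = 2" "index a = 3" "odd (period a)" "j \<ge> 3"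
    using assms by linarith
  then show ?thesis
  proof cases
    case 1
    then show ?thesis
      using monogenic_pair_in_kernel \<open>i \<le> j\<close> le_trans by blast
  next
    case 2
    then have "\<langle>{spow a i, spow a j}\<rangle> = \<langle>{a}\<rangle>"
      using \<open>0 < i\<close> \<open>i \<le> j\<close>
      by (intro gen_pair_eq_singletonI) (auto intro: gen.base spow_in_gen)
    then show ?thesis ..
  next
    case 3
    then show ?thesis by auto
  next
    case 4
    have "spow a j \<in> \<langle>{spow a 2}\<rangle>"
    proof (cases "even j")
      case True
      then obtain t where "j = 2 * t" by (rule evenE)
      then show ?thesis
        using spow_mult_in_gen[of 2 t a] \<open>j \<ge> 3\<close> by auto
    next
      case False
      then obtain t where t: "j + period a = 2 * t"
        using 4 by (metis evenE odd_even_add)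
      have "spow a j = spow a (2 * t)"
        using spow_add_period_mult[of a j 1] 4 t by simp
      then show ?thesis
        using spow_mult_in_gen[of 2 t a] \<open>j \<ge> 3\<close> t by auto
    qed
    then have "\<langle>{spow a i, spow a j}\<rangle> = \<langle>{spow a 2}\<rangle>"
      using 4 by (intro gen_pair_eq_singletonI) (auto intro: gen.base)
    then show ?thesis ..
  qed
qed

lemma gen_square_cube_exponents:
  assumes "z \<in> \<langle>{spow a 2, spow a 3}\<rangle>"
  shows "\<exists>k\<ge>2. z = spow a k"
  using assms
proof induction
  case (mult x y)
  then obtain k l where "x = spow a k" "k \<ge> 2" "y = spow a l" "l \<ge> 2"
    by auto
  then show ?case
    by (intro exI[of _ "k + l"]) (auto simp: spow_add)
next
  case (base x)
  then consider "x = spow a 2" | "x = spow a 3" by auto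
  then show ?case
    by cases (auto intro: exI[of _ 2] exI[of _ 3])
qed

text \<open>A generator \<open>z\<close> of \<open>\<langle>a\<^sup>2, a\<^sup>3\<rangle>\<close> is some \<open>a\<^sup>k\<close> with \<open>k \<ge> 2\<close>, and
  \<open>a\<^sup>2 = z\<^sup>t = a\<^bsup>kt\<^esup>\<close>. As \<open>2\<close> lies below the index, \<open>k t = 2\<close>, so
  \<open>z = a\<^sup>2\<close> and \<open>a\<^sup>3\<close> must equal an even power of \<open>a\<close>.\<close>

lemma square_cube_not_monogenic:
  fixes a :: "'a::{semigroup_mult, finite}"
  assumes m: "index a \<ge> 3" and bad: "index a = 3 \<Longrightarrow> even (period a)"
  shows "\<langle>{spow a 2, spow a 3}\<rangle> \<noteq> \<langle>{z}\<rangle>"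
proof
  assume gen: "\<langle>{spow a 2, spow a 3}\<rangle> = \<langle>{z}\<rangle>"
  obtain k where k: "k \<ge> 2" "z = spow a k"
    using gen_square_cube_exponents[of z a] gen by (auto intro: gen.base)
  have "spow a 2 \<in> \<langle>{z}\<rangle>" "spow a 3 \<in> \<langle>{z}\<rangle>"
    using gen by (auto intro: gen.base simp flip: gen)
  then obtain t s where t: "t > 0" "spow a 2 = spow a (k * t)"
    and s: "s > 0" "spow a 3 = spow a (k * s)"
    using k by (auto simp: gen_singleton spow_mult)
  have "k * t = 2"
    using spow_eq_below_index[OF t(2)] m k t(1) by simp
  moreover have "k \<le> k * t"
    using t(1) by simp
  ultimately have "k = 2"
    using k by simp
  with s have cube: "spow a 3 = spow a (2 * s)"
    by simp
  show False
  proof (cases "index a = 3")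
    case True
    have "s \<noteq> 1"
      using cube spow_eq_below_index[of a 2 3] True by auto
    then have "spow a (index a + (2 * s - 3)) = spow a (index a)"
      using s(1) cube True by simp
    then have "period a dvd 2 * s - 3"
      by (rule period_dvd)
    then have "even (2 * s - 3)"
      using bad[OF True] dvd_trans by blast
    then show False
      using s(1) \<open>s \<noteq> 1\<close> by presburger
  next
    case False
    then have "2 * s = 3"
      using spow_eq_below_index[OF cube] m s(1) by simp
    then show False by presburger
  qed
qed

section \<open>Equality of the two graphs\<close>

lemma graphs_eq_iff:
  "(P\<^sub>e :: 'a::semigroup_mult graph) = \<Gamma> \<longleftrightarrow>
    (\<forall>a :: 'a. \<forall>i>0. \<forall>j>0. \<exists>w. \<langle>{spow a i, spow a j}\<rangle> = \<langle>{w}\<rangle>)"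
  (is "_ \<longleftrightarrow> ?pairs")
proof
  assume eq: "(P\<^sub>e :: 'a graph) = \<Gamma>"
  show ?pairs
  proof (intro allI impI)
    fix a :: 'a and i j :: nat
    assume pos: "i > 0" "j > 0"
    let ?x = "spow a i" and ?y = "spow a j"
    show "\<exists>w. \<langle>{?x, ?y}\<rangle> = \<langle>{w}\<rangle>"
    proof (cases "?x = ?y")
      case False
      have "?x \<in> \<langle>{a}\<rangle>" "?y \<in> \<langle>{a}\<rangle>"
        using pos by (auto simp: gen_singleton)
      then have "{?x, ?y} \<in> snd (P\<^sub>e :: 'a graph)"
        using False unfolding enhanced_power_graph_def by auto
      then have "{?x, ?y} \<in> snd (\<Gamma> :: 'a graph)"
        by (simp only: eq)
      then obtain x y w where "{?x, ?y} = {x, y}" "\<langle>{x, y}\<rangle> = \<langle>{w}\<rangle>"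
        unfolding cyclic_graph_def by auto
      then show ?thesis by metis
    qed auto
  qed
next
  assume pairs: ?pairs
  have "(\<exists>z. x \<in> \<langle>{z}\<rangle> \<and> y \<in> \<langle>{z}\<rangle>) \<longleftrightarrow> (\<exists>w. \<langle>{x, y}\<rangle> = \<langle>{w}\<rangle>)" for x y :: 'a
  proof
    assume "\<exists>z. x \<in> \<langle>{z}\<rangle> \<and> y \<in> \<langle>{z}\<rangle>"
    then show "\<exists>w. \<langle>{x, y}\<rangle> = \<langle>{w}\<rangle>"
      using pairs by (auto simp: gen_singleton)
  next
    assume "\<exists>w. \<langle>{x, y}\<rangle> = \<langle>{w}\<rangle>"
    then obtain w where "\<langle>{x, y}\<rangle> = \<langle>{w}\<rangle>" ..
    moreover have "x \<in> \<langle>{x, y}\<rangle>" "y \<in> \<langle>{x, y}\<rangle>"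
      by (auto intro: gen.base)
    ultimately show "\<exists>z. x \<in> \<langle>{z}\<rangle> \<and> y \<in> \<langle>{z}\<rangle>"
      by auto
  qed
  then show "(P\<^sub>e :: 'a graph) = \<Gamma>"
    unfolding enhanced_power_graph_def cyclic_graph_def by simp
qed

theorem theorem4p2:
  "(P\<^sub>e :: 'a::{semigroup_mult, finite} graph) = \<Gamma> \<longleftrightarrow>
    (\<forall>a :: 'a. \<exists>r>0. monogenic a 1 r \<or> monogenic a 2 r \<or> (monogenic a 3 r \<and> odd r))"
proof -
  have "(\<forall>i>0. \<forall>j>0. \<exists>w. \<langle>{spow a i, spow a j}\<rangle> = \<langle>{w}\<rangle>) \<longleftrightarrow>
      (\<exists>r>0. monogenic a 1 r \<or> monogenic a 2 r \<or> (monogenic a 3 r \<and> odd r))"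
    (is "?pairs \<longleftrightarrow> ?types") for a :: 'a
  proof -
    have types: "?types \<longleftrightarrow> index a \<le> 2 \<or> (index a = 3 \<and> odd (period a))"
      using index_period_exist(1,3)[of a] by (auto simp: monogenic_def)
    show ?thesis
    proof
      assume ?pairs
      then have "\<exists>w. \<langle>{spow a 2, spow a 3}\<rangle> = \<langle>{w}\<rangle>"
        by simp
      then have "\<not> (index a \<ge> 3 \<and> (index a = 3 \<longrightarrow> even (period a)))"
        using square_cube_not_monogenic[of a] by blast
      then show ?types
        unfolding types by linarith
    next
      assume ?types
      then have small: "index a \<le> 2 \<or> (index a = 3 \<and> odd (period a))"
        unfolding types .
      show ?pairs
      proof (intro allI impI)
        fix i j :: nat
        assume "i > 0" "j > 0"
        then show "\<exists>w. \<langle>{spow a i, spow a j}\<rangle> = \<langle>{w}\<rangle>"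
          using monogenic_pair_of_small_index[OF small, of i j]
            monogenic_pair_of_small_index[OF small, of j i]
          by (cases "i \<le> j") (auto simp: insert_commute)
      qed
    qed
  qed
  then show ?thesis
    by (simp only: graphs_eq_iff)
qed

end
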